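(* Let $G$ and $H$ be finite simple connected graphs. If the strong product $G\boxtimes H$ is a DDR graph, then both $G$ and $H$ are DDR graphs.
   Context: All graphs are finite, simple and connected. $\Gamma_i(u)$ is the set of vertices at distance exactly $i$ from $u$. A graph is DDR (distance degree-regular) if $|\Gamma_i(u)|=|\Gamma_i(v)|$ for all vertices $u,v$ and all $i$. The strong product $G\boxtimes H$ has vertex set $V(G)\times V(H)$, and $(g_1,h_1)\sim(g_2,h_2)$ iff ($g_1\sim g_2$ and $h_1=h_2$) or ($g_1=g_2$ and $h_1\sim h_2$) or ($g_1\sim g_2$ and $h_1\sim h_2$). *)

theory Defs
  imports "Graph_Theory.Graph_Theory"
begin

text \<open>
  A finite simple graph is a \<^locale>\<open>pair_graph\<close>: a finite, loop-free, symmetric set of pairs of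
  vertices. The constant \<^const>\<open>with_proj\<close> embeds these into the general digraphs of the library.
\<close>

text \<open>
  The vertices at distance exactly \<open>i\<close> from \<open>u\<close>. The distance is the least cost of a walk
  when every arc costs 1; it is \<open>\<infinity>\<close> if there is no walk.
\<close>

definition distance_layer :: "('a, 'b) pre_digraph \<Rightarrow> nat \<Rightarrow> 'a \<Rightarrow> 'a set" where
  "distance_layer G i u = {v \<in> verts G. wf_digraph.\<mu> G (\<lambda>_. 1) u v = ereal (real i)}"

definition distance_degree_regular :: "('a, 'b) pre_digraph \<Rightarrow> bool" where
  "distance_degree_regular G \<longleftrightarrow>
     (\<forall>u \<in> verts G. \<forall>v \<in> verts G. \<forall>i.
        card (distance_layer G i u) = card (distance_layer G i v))"

definition strong_product ::
    "'a pair_pre_digraph \<Rightarrow> 'b pair_pre_digraph \<Rightarrow> ('a \<times> 'b) pair_pre_digraph" where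
  "strong_product G H =
     \<lparr> pverts = pverts G \<times> pverts H,
       parcs = {((g1, h1), (g2, h2)) | g1 h1 g2 h2.
         g1 \<in> pverts G \<and> g2 \<in> pverts G \<and> h1 \<in> pverts H \<and> h2 \<in> pverts H \<and>
         ((g1, g2) \<in> parcs G \<and> h1 = h2 \<or>
          g1 = g2 \<and> (h1, h2) \<in> parcs H \<or>
          (g1, g2) \<in> parcs G \<and> (h1, h2) \<in> parcs H)} \<rparr>"

lemma pair_graph_strong_product:
  assumes "pair_graph G" and "pair_graph H"
  shows "pair_graph (strong_product G H)"
proof -
  interpret G: pair_graph G by fact
  interpret H: pair_graph H by fact
  have sG: "(a, b) \<in> parcs G \<Longrightarrow> (b, a) \<in> parcs G" for a b
    using G.pair_sym_arcs by (simp add: symmetric_def sym_def)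
  have sH: "(a, b) \<in> parcs H \<Longrightarrow> (b, a) \<in> parcs H" for a b
    using H.pair_sym_arcs by (simp add: symmetric_def sym_def)
  have sub: "parcs (strong_product G H) \<subseteq>
      (pverts G \<times> pverts H) \<times> (pverts G \<times> pverts H)"
    by (auto simp: strong_product_def)
  have fin: "finite (pverts G \<times> pverts H)"
    using G.pair_finite_verts H.pair_finite_verts by blast
  show ?thesis
  proof
    show "finite (pverts (strong_product G H))"
      using fin by (simp add: strong_product_def)
    show "finite (parcs (strong_product G H))"
      by (rule finite_subset[OF sub]) (use fin in blast)
    show "symmetric (with_proj (strong_product G H))"
      unfolding symmetric_def sym_def by (auto simp: strong_product_def intro: sG sH)
    show "fst e \<noteq> snd e" if "e \<in> parcs (strong_product G H)" for e
      using that G.pair_no_loops H.pair_no_loops by (fastforce simp: strong_product_def)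
  qed (auto simp: strong_product_def)
qed

end

theory Submission
  imports Defs
begin

text \<open>
  Let \<open>B n x\<close> be the ball of radius \<open>n\<close> around \<open>x\<close>. A step in the strong product that is also
  allowed to stand still is nothing but an independent choice of such a lazy step in each factor.
  Hence a lazy walk of length \<open>n\<close> in the product is a pair of lazy walks of length \<open>n\<close>, and since
  the ball of radius \<open>n\<close> consists of the end points of these walks, \<open>B n (g, h) = B n g \<times> B n h\<close>
  (\<open>distance_ball_strong_product\<close>).

  The layers are the differences of successive balls, so a graph is distance degree-regular
  exactly if the size of a ball depends on its radius only
  (\<open>distance_degree_regular_iff_balls\<close>). If this holds for the product, then
  \<open>card (B n g) * card (B n h)\<close> does not depend on \<open>g\<close> and \<open>h\<close>. Fixing one of the two vertices
  and cancelling its factor, which is positive because a ball contains its centre, gives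
  the claim for the other graph. There is a vertex to fix because connected graphs are nonempty.
\<close>

section \<open>Balls and layers\<close>

definition distance_ball :: "('a, 'b) pre_digraph \<Rightarrow> nat \<Rightarrow> 'a \<Rightarrow> 'a set" where
  "distance_ball G n u = {v \<in> verts G. wf_digraph.\<mu> G (\<lambda>_. 1) u v \<le> ereal (real n)}"

context wf_digraph
begin

lemma awalk_cost_one: "awalk_cost (\<lambda>_. 1) p = real (length p)"
  by (induct p) auto

text \<open>
  The distance is an infimum of natural numbers, so a bound by a natural number is attained:
  a walk of length less than \<open>n + 1\<close> has length at most \<open>n\<close>.
\<close>

lemma unit_distance_le_iff:
  "\<mu> (\<lambda>_. 1) u v \<le> ereal (real n) \<longleftrightarrow> (\<exists>p. awalk u p v \<and> length p \<le> n)"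
proof
  assume "\<mu> (\<lambda>_. 1) u v \<le> ereal (real n)"
  also have "\<dots> < ereal (real (Suc n))"
    by simp
  finally obtain p where "awalk u p v" "length p < Suc n"
    by (auto simp: \<mu>_def INF_less_iff awalk_cost_one)
  then show "\<exists>p. awalk u p v \<and> length p \<le> n"
    by auto
next
  assume "\<exists>p. awalk u p v \<and> length p \<le> n"
  then obtain p where "awalk u p v" "length p \<le> n"
    by blast
  then show "\<mu> (\<lambda>_. 1) u v \<le> ereal (real n)"
    using min_cost_le_walk_cost[of u p v "\<lambda>_. 1"]
    by (auto simp: awalk_cost_one intro: order_trans)
qed

lemma le_unit_distance_iff:
  "ereal (real n) \<le> \<mu> (\<lambda>_. 1) u v \<longleftrightarrow> (\<forall>p. awalk u p v \<longrightarrow> n \<le> length p)"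
  by (auto simp: \<mu>_def le_INF_iff awalk_cost_one)

lemma distance_layer_0: "distance_layer G 0 u = distance_ball G 0 u"
  using le_unit_distance_iff[of 0 u]
  by (auto simp: distance_layer_def distance_ball_def intro: antisym)

lemma distance_layer_Suc:
  "distance_layer G (Suc n) u = distance_ball G (Suc n) u - distance_ball G n u"
proof -
  have "\<mu> (\<lambda>_. 1) u v = ereal (real (Suc n)) \<longleftrightarrow>
      \<mu> (\<lambda>_. 1) u v \<le> ereal (real (Suc n)) \<and> \<not> \<mu> (\<lambda>_. 1) u v \<le> ereal (real n)" for v
  proof -
    have "ereal (real (Suc n)) \<le> \<mu> (\<lambda>_. 1) u v \<longleftrightarrow> \<not> \<mu> (\<lambda>_. 1) u v \<le> ereal (real n)"
      unfolding unit_distance_le_iff le_unit_distance_iff by (auto simp: not_le Suc_le_eq)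
    then show ?thesis
      by (metis antisym order_refl)
  qed
  then show ?thesis
    unfolding distance_layer_def distance_ball_def by blast
qed

lemma distance_ball_mono: "m \<le> n \<Longrightarrow> distance_ball G m u \<subseteq> distance_ball G n u"
  unfolding distance_ball_def unit_distance_le_iff by (blast intro: order_trans)

lemma centre_in_distance_ball: "u \<in> verts G \<Longrightarrow> u \<in> distance_ball G n u"
  unfolding distance_ball_def unit_distance_le_iff
  by (auto simp: awalk_Nil_iff intro!: exI[of _ "[]"])

end

context fin_digraph
begin

lemma finite_distance_ball: "finite (distance_ball G n u)"
  unfolding distance_ball_def by simp

lemma card_distance_ball_Suc:
  "card (distance_ball G (Suc n) u) =
     card (distance_ball G n u) + card (distance_layer G (Suc n) u)"
  using card_Diff_subset[OF finite_distance_ball distance_ball_mono[of n "Suc n" u]]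
    card_mono[OF finite_distance_ball distance_ball_mono[of n "Suc n" u]]
  by (simp add: distance_layer_Suc)

text \<open>
  Passing from layers to balls is summation, and passing back is taking differences. Balls are
  the better notion here because the layers of a product are not products of layers.
\<close>

lemma distance_degree_regular_iff_balls:
  "distance_degree_regular G \<longleftrightarrow>
     (\<forall>u \<in> verts G. \<forall>v \<in> verts G. \<forall>n.
        card (distance_ball G n u) = card (distance_ball G n v))" (is "_ \<longleftrightarrow> ?balls")
proof
  assume layers: "distance_degree_regular G"
  show ?balls
  proof (intro ballI allI)
    fix u v n
    assume "u \<in> verts G" "v \<in> verts G"
    with layers have "card (distance_layer G i u) = card (distance_layer G i v)" for i
      unfolding distance_degree_regular_def by blast
    then show "card (distance_ball G n u) = card (distance_ball G n v)"
      by (induct n) (simp_all add: card_distance_ball_Suc flip: distance_layer_0)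
  qed
next
  assume balls: ?balls
  show "distance_degree_regular G"
    unfolding distance_degree_regular_def
  proof (intro ballI allI)
    fix u v i
    assume "u \<in> verts G" "v \<in> verts G"
    with balls have eq: "card (distance_ball G n u) = card (distance_ball G n v)" for n
      by blast
    show "card (distance_layer G i u) = card (distance_layer G i v)"
    proof (cases i)
      case 0
      then show ?thesis
        using eq by (simp add: distance_layer_0)
    next
      case (Suc n)
      then show ?thesis
        using eq[of "Suc n"] eq[of n] by (simp add: card_distance_ball_Suc)
    qed
  qed
qed

end

section \<open>Lazy walks in the strong product\<close>

definition lazy_step :: "'a pair_pre_digraph \<Rightarrow> 'a rel" where
  "lazy_step G = Id_on (pverts G) \<union> parcs G"

text \<open>
  Standing still pads a walk of length at most \<open>n\<close> to exactly \<open>n\<close> steps, so that walks of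
  different lengths in the two factors can later be run in parallel.
\<close>

lemma (in pair_wf_digraph) short_walk_iff_lazy_walk:
  assumes "u \<in> pverts G"
  shows "(\<exists>p. awalk u p v \<and> length p \<le> n) \<longleftrightarrow> (u, v) \<in> lazy_step G ^^ n"
  using assms
proof (induct n arbitrary: u)
  case 0
  then show ?case
    by (auto simp: awalk_Nil_iff)
next
  case (Suc n)
  have "(\<exists>p. awalk u p v \<and> length p \<le> Suc n) \<longleftrightarrow>
      (\<exists>w. (u, w) \<in> lazy_step G \<and> (\<exists>p. awalk w p v \<and> length p \<le> n))" (is "?L \<longleftrightarrow> ?R")
  proof
    assume ?L
    then obtain p where p: "awalk u p v" "length p \<le> Suc n"
      by blast
    show ?R
    proof (cases p)
      case Nil
      then show ?thesis
        using p Suc.prems by (auto simp: lazy_step_def intro!: exI[of _ u] exI[of _ "[]"])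
    next
      case (Cons e q)
      then show ?thesis
        using p by (auto simp: lazy_step_def awalk_Cons_iff intro!: exI[of _ "snd e"])
    qed
  next
    assume ?R
    then obtain w p where w: "(u, w) \<in> lazy_step G" and p: "awalk w p v" "length p \<le> n"
      by blast
    show ?L
    proof (cases "(u, w) \<in> parcs G")
      case True
      then show ?thesis
        using p by (intro exI[of _ "(u, w) # p"]) (auto simp: awalk_Cons_iff)
    next
      case False
      then show ?thesis
        using w p by (auto simp: lazy_step_def intro!: exI[of _ p])
    qed
  qed
  also have "\<dots> \<longleftrightarrow> (\<exists>w. (u, w) \<in> lazy_step G \<and> (w, v) \<in> lazy_step G ^^ n)"
  proof -
    have "w \<in> pverts G" if "(u, w) \<in> lazy_step G" for w
      using that by (auto simp: lazy_step_def dest: in_arcsD2)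
    then show ?thesis
      using Suc.hyps by blast
  qed
  also have "\<dots> \<longleftrightarrow> (u, v) \<in> lazy_step G ^^ Suc n"
    by (blast intro: relpow_Suc_I2 dest: relpow_Suc_D2)
  finally show ?case .
qed

lemma (in pair_wf_digraph) distance_ball_eq_lazy_walks:
  assumes "u \<in> pverts G"
  shows "distance_ball (with_proj G) n u = (lazy_step G ^^ n) `` {u}"
  using short_walk_iff_lazy_walk[OF assms, of _ n]
  by (auto simp: distance_ball_def unit_distance_le_iff)

text \<open>
  The three kinds of arcs of the strong product are the pairs of lazy steps in which at least
  one coordinate follows an arc; the remaining pairs stand still in both coordinates.
\<close>

lemma lazy_step_strong_product:
  assumes "pair_wf_digraph G" and "pair_wf_digraph H"
  shows "((g, h), (g', h')) \<in> lazy_step (strong_product G H) \<longleftrightarrow>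
    (g, g') \<in> lazy_step G \<and> (h, h') \<in> lazy_step H"
  using pair_wf_digraph.wellformed'[OF assms(1)] pair_wf_digraph.wellformed'[OF assms(2)]
  by (auto simp: lazy_step_def strong_product_def)

lemma lazy_walk_strong_product:
  assumes "pair_wf_digraph G" and "pair_wf_digraph H"
  shows "((g, h), (g', h')) \<in> lazy_step (strong_product G H) ^^ n \<longleftrightarrow>
    (g, g') \<in> lazy_step G ^^ n \<and> (h, h') \<in> lazy_step H ^^ n"
proof (induct n arbitrary: g' h')
  case 0
  then show ?case
    by simp
next
  case (Suc n)
  then show ?case
    by (auto simp: relcomp_unfold lazy_step_strong_product[OF assms])
qed

lemma distance_ball_strong_product:
  assumes "pair_graph G" and "pair_graph H" and "g \<in> pverts G" and "h \<in> pverts H"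
  shows "distance_ball (with_proj (strong_product G H)) n (g, h) =
    distance_ball (with_proj G) n g \<times> distance_ball (with_proj H) n h"
proof -
  interpret G: pair_graph G by fact
  interpret H: pair_graph H by fact
  interpret P: pair_graph "strong_product G H"
    using assms(1,2) by (rule pair_graph_strong_product)
  have "(g, h) \<in> pverts (strong_product G H)"
    using assms by (simp add: strong_product_def)
  then show ?thesis
    using assms lazy_walk_strong_product[OF G.pair_wf_digraph_axioms H.pair_wf_digraph_axioms]
    by (auto simp: P.distance_ball_eq_lazy_walks G.distance_ball_eq_lazy_walks
        H.distance_ball_eq_lazy_walks)
qed

section \<open>Regularity of the factors\<close>

theorem theorem3p8:
  fixes G :: "'a pair_pre_digraph" and H :: "'b pair_pre_digraph"
  assumes "pair_graph G" and "Digraph_Component.connected (with_proj G)"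
    and "pair_graph H" and "Digraph_Component.connected (with_proj H)"
    and "distance_degree_regular (with_proj (strong_product G H))"
  shows "distance_degree_regular (with_proj G) \<and> distance_degree_regular (with_proj H)"
proof -
  interpret G: pair_graph G by fact
  interpret H: pair_graph H by fact
  interpret P: pair_graph "strong_product G H"
    using assms(1,3) by (rule pair_graph_strong_product)
  have "pverts G \<noteq> {}" "pverts H \<noteq> {}"
    using assms(2,4) by (auto simp: Digraph_Component.connected_def strongly_connected_def)
  then obtain g0 h0 where g0: "g0 \<in> pverts G" and h0: "h0 \<in> pverts H"
    by blast
  have product_const:
    "card (distance_ball (with_proj G) n g) * card (distance_ball (with_proj H) n h) =
     card (distance_ball (with_proj G) n g') * card (distance_ball (with_proj H) n h')"
    if "g \<in> pverts G" "g' \<in> pverts G" "h \<in> pverts H" "h' \<in> pverts H" for g g' h h' n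
  proof -
    have "(g, h) \<in> pverts (strong_product G H)" "(g', h') \<in> pverts (strong_product G H)"
      using that by (simp_all add: strong_product_def)
    then have "card (distance_ball (with_proj (strong_product G H)) n (g, h)) =
        card (distance_ball (with_proj (strong_product G H)) n (g', h'))"
      using assms(5) P.distance_degree_regular_iff_balls by blast
    then show ?thesis
      using that by (simp add: distance_ball_strong_product[OF assms(1,3)] card_cartesian_product)
  qed
  have pos: "card (distance_ball (with_proj G) n g0) > 0"
    "card (distance_ball (with_proj H) n h0) > 0" for n
    using G.centre_in_distance_ball[OF g0, of n] G.finite_distance_ball[of n g0]
      H.centre_in_distance_ball[OF h0, of n] H.finite_distance_ball[of n h0]
    unfolding card_gt_0_iff by blast+
  show ?thesis
    unfolding G.distance_degree_regular_iff_balls H.distance_degree_regular_iff_balls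
  proof (intro conjI ballI allI)
    fix g g' n
    assume "g \<in> pverts G" "g' \<in> pverts G"
    then show "card (distance_ball (with_proj G) n g) = card (distance_ball (with_proj G) n g')"
      using product_const[of g g' h0 h0 n] pos(2)[of n] h0 by simp
  next
    fix h h' n
    assume "h \<in> pverts H" "h' \<in> pverts H"
    then show "card (distance_ball (with_proj H) n h) = card (distance_ball (with_proj H) n h')"
      using product_const[of g0 g0 h h' n] pos(1)[of n] g0 by simp
  qed
qed

end
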